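(* Let $G=(X\cup Y,E)$ be a bipartite graph and $\mathcal{I}$ a partition of $X$. Let the inequality $a^T(x,y,z)\le b$ be valid (respectively facet-inducing) for $P(G,\mathcal{I})$, let $\hat Y\subseteq Y$, and define $$\hat a_i=a_i+\sum_{j\in\hat Y\cap N(i)}a_{ij}\quad\text{for } i\in X,\qquad \hat a_j=\begin{cases}-a_j&\text{for } j\in\hat Y\\ a_j&\text{for } j\in Y\setminus\hat Y,\end{cases}$$ $$\hat a_{ij}=\begin{cases}-a_{ij}&\text{for }\{i,j\}\in E\text{ with } j\in\hat Y\\ a_{ij}&\text{for all other }\{i,j\}\in E,\end{cases}\qquad \hat b=b-\sum_{j\in\hat Y}a_j.$$ Then $\hat a^T(x,y,z)\le\hat b$ is also a valid (respectively facet-inducing) inequality for $P(G,\mathcal{I})$.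
   Context: $G=(X\cup Y,E)$ is a finite bipartite graph with disjoint node sets $X,Y$; every edge $\{i,j\}\in E$ has $i\in X$, $j\in Y$. $\mathcal{I}$ is a partition of $X$ into non-empty subsets. $N(v)$ is the set of neighbours of $v$. Vectors in $\mathbb{R}^{X\cup Y\cup E}$ are written $(x,y,z)$; a coefficient vector $a\in\mathbb{R}^{X\cup Y\cup E}$ has components $a_i$ ($i\in X$), $a_j$ ($j\in Y$), $a_{ij}$ ($\{i,j\}\in E$). Put $X^{\mathcal{I}}=\{x\in\{0,1\}^X : \sum_{i\in I}x_i\le 1\ \forall I\in\mathcal{I}\}$ and $$P(G,\mathcal{I})=\operatorname{conv}\{(x,y,z)\in\{0,1\}^{X\cup Y\cup E} : x_iy_j=z_{ij}\ \forall\{i,j\}\in E,\ x\in X^{\mathcal{I}}\}.$$ *)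

theory Defs
  imports "HOL-Analysis.Analysis" "HOL-Library.Disjoint_Sets" "HOL-Library.FuncSet"
begin

text \<open>
  A finite bipartite graph is given by node sets \<open>X\<close>, \<open>Y\<close> inside a finite type \<open>'v\<close> and a set \<open>E\<close>
  of two-element node sets. The sets need not exhaust the type, so each of them may be empty.
\<close>

definition bipartite_graph :: "'v::finite set \<Rightarrow> 'v set \<Rightarrow> 'v set set \<Rightarrow> bool" where
  "bipartite_graph X Y E \<longleftrightarrow> X \<inter> Y = {} \<and> (\<forall>e\<in>E. \<exists>i\<in>X. \<exists>j\<in>Y. e = {i, j})"

definition neighbours :: "'v set set \<Rightarrow> 'v \<Rightarrow> 'v set" where
  "neighbours E v = {w. {v, w} \<in> E}"

text \<open>
  The space of vectors indexed by \<open>X \<union> Y \<union> E\<close> is represented as the coordinate subspace of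
  \<open>real ^ ('v + 'v set)\<close> of vectors vanishing outside \<open>(X \<union> Y) <+> E\<close>: the component of a
  node \<open>v\<close> is \<open>u $ Inl v\<close>, the component of an edge \<open>{i, j}\<close> is \<open>u $ Inr {i, j}\<close>. On this subspace
  the inner product of the surrounding space is the sum over \<open>X \<union> Y \<union> E\<close>.
\<close>

definition coord_space ::
  "'v::finite set \<Rightarrow> 'v set \<Rightarrow> 'v set set \<Rightarrow> (real ^ ('v + 'v set)) set" where
  "coord_space X Y E = {u. \<forall>k. k \<notin> (X \<union> Y) <+> E \<longrightarrow> u $ k = 0}"

definition choice_vectors :: "'v set \<Rightarrow> 'v set set \<Rightarrow> ('v \<Rightarrow> real) set" where
  "choice_vectors X \<I> = {x \<in> X \<rightarrow>\<^sub>E {0, 1}. \<forall>I\<in>\<I>. (\<Sum>i\<in>I. x i) \<le> 1}"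

definition bilinear_polytope ::
  "'v::finite set \<Rightarrow> 'v set \<Rightarrow> 'v set set \<Rightarrow> 'v set set \<Rightarrow> (real ^ ('v + 'v set)) set" where
  "bilinear_polytope X Y E \<I> = convex hull
     {u \<in> coord_space X Y E.
        (\<forall>k \<in> (X \<union> Y) <+> E. u $ k \<in> {0, 1}) \<and>
        (\<forall>i\<in>X. \<forall>j\<in>Y. {i, j} \<in> E \<longrightarrow> u $ Inl i * u $ Inl j = u $ Inr {i, j}) \<and>
        (\<lambda>i\<in>X. u $ Inl i) \<in> choice_vectors X \<I>}"

definition valid_inequality :: "'a::real_inner set \<Rightarrow> 'a \<Rightarrow> real \<Rightarrow> bool" where
  "valid_inequality P a b \<longleftrightarrow> (\<forall>u\<in>P. a \<bullet> u \<le> b)"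

definition facet_inducing :: "'a::euclidean_space set \<Rightarrow> 'a \<Rightarrow> real \<Rightarrow> bool" where
  "facet_inducing P a b \<longleftrightarrow> valid_inequality P a b \<and> (P \<inter> {u. a \<bullet> u = b}) facet_of P"

definition switched_coeffs ::
  "'v::finite set \<Rightarrow> 'v set set \<Rightarrow> 'v set \<Rightarrow> real ^ ('v + 'v set) \<Rightarrow> real ^ ('v + 'v set)" where
  "switched_coeffs X E Yh a = (\<chi> k. case k of
       Inl v \<Rightarrow> if v \<in> X then a $ Inl v + (\<Sum>j \<in> Yh \<inter> neighbours E v. a $ Inr {v, j})
                else if v \<in> Yh then - (a $ Inl v)
                else a $ Inl v
     | Inr e \<Rightarrow> if \<exists>j\<in>Yh. j \<in> e then - (a $ Inr e) else a $ Inr e)"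

definition switched_rhs :: "'v::finite set \<Rightarrow> real ^ ('v + 'v set) \<Rightarrow> real \<Rightarrow> real" where
  "switched_rhs Yh a b = b - (\<Sum>j\<in>Yh. a $ Inl j)"

end

theory Submission
  imports Defs
begin

text \<open>
  Complementing \<open>y\<^sub>j\<close> for \<open>j \<in> Yh\<close>, that is, replacing \<open>y\<^sub>j\<close> by \<open>1 - y\<^sub>j\<close> and
  \<open>z\<^sub>i\<^sub>j\<close> by \<open>x\<^sub>i - z\<^sub>i\<^sub>j\<close>, is an affine involution that permutes the 0/1 points spanning the
  polytope, hence maps the polytope onto itself and facets to facets. Pulling back \<open>a\<^sup>T u \<le> b\<close>
  along this involution gives exactly the switched inequality.
\<close>

text \<open>For an edge \<open>e\<close> the set \<open>X \<inter> e\<close> is a singleton, so the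
  sum is just the value at the X-endpoint, obtained without choosing an orientation of
  \<open>e\<close>. The guard \<open>e \<in> E\<close> keeps coordinates of non-edges at 0, so
  \<open>coord_space\<close> is preserved.\<close>

definition switch_linear ::
  "'v::finite set \<Rightarrow> 'v set set \<Rightarrow> 'v set \<Rightarrow> real ^ ('v + 'v set) \<Rightarrow> real ^ ('v + 'v set)" where
  "switch_linear X E Yh u = (\<chi> k. case k of
       Inl v \<Rightarrow> if v \<in> Yh then - (u $ Inl v) else u $ Inl v
     | Inr e \<Rightarrow> if e \<in> E \<and> (\<exists>j\<in>Yh. j \<in> e) then (\<Sum>i\<in>X \<inter> e. u $ Inl i) - u $ Inr e
                else u $ Inr e)"

definition switch_shift :: "'v::finite set \<Rightarrow> real ^ ('v + 'v set)" where
  "switch_shift Yh = (\<chi> k. case k of Inl v \<Rightarrow> if v \<in> Yh then 1 else 0 | Inr e \<Rightarrow> 0)"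

definition switch ::
  "'v::finite set \<Rightarrow> 'v set set \<Rightarrow> 'v set \<Rightarrow> real ^ ('v + 'v set) \<Rightarrow> real ^ ('v + 'v set)" where
  "switch X E Yh u = switch_shift Yh + switch_linear X E Yh u"

lemma switch_nth_Inl [simp]:
  "switch X E Yh u $ Inl v = (if v \<in> Yh then 1 - u $ Inl v else u $ Inl v)"
  by (simp add: switch_def switch_linear_def switch_shift_def)

lemma switch_nth_Inr [simp]:
  "switch X E Yh u $ Inr e =
    (if e \<in> E \<and> (\<exists>j\<in>Yh. j \<in> e) then (\<Sum>i\<in>X \<inter> e. u $ Inl i) - u $ Inr e else u $ Inr e)"
  by (simp add: switch_def switch_linear_def switch_shift_def)

lemma vec_sum_eqI:
  fixes u w :: "'c ^ ('a::finite + 'b::finite)"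
  assumes "\<And>v. u $ Inl v = w $ Inl v" "\<And>e. u $ Inr e = w $ Inr e"
  shows "u = w"
  unfolding vec_eq_iff using assms by (metis sumE)

lemma inner_vec_sum:
  fixes u w :: "real ^ ('a::finite + 'b::finite)"
  shows "u \<bullet> w = (\<Sum>v\<in>UNIV. u $ Inl v * w $ Inl v) + (\<Sum>e\<in>UNIV. u $ Inr e * w $ Inr e)"
  unfolding inner_vec_def UNIV_Plus_UNIV[symmetric] by (subst sum.Plus) auto

text \<open>Nodes of \<open>X\<close> are not complemented, so the sum s over
  \<open>X \<inter> e\<close> is the same before and after switching, and s - (s - z) = z.\<close>

lemma switch_involution:
  assumes "X \<inter> Yh = {}"
  shows "switch X E Yh (switch X E Yh u) = u"
proof (rule vec_sum_eqI)
  fix e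
  have "(\<Sum>i\<in>X \<inter> e. switch X E Yh u $ Inl i) = (\<Sum>i\<in>X \<inter> e. u $ Inl i)"
    using assms by (intro sum.cong) auto
  then show "switch X E Yh (switch X E Yh u) $ Inr e = u $ Inr e"
    by (auto simp del: switch_nth_Inl)
qed simp

lemma linear_switch_linear: "linear (switch_linear X E Yh)"
  by (rule linearI; rule vec_sum_eqI)
     (auto simp: switch_linear_def sum.distrib sum_distrib_left algebra_simps)

text \<open>The involution \<open>switch\<close> is injective and differs from its linear part only
  by a constant vector.\<close>

lemma inj_switch_linear:
  assumes "X \<inter> Yh = {}"
  shows "inj (switch_linear X E Yh)"
  by (metis assms injI switch_def switch_involution)

lemma inner_switch_shift: "a \<bullet> switch_shift Yh = (\<Sum>j\<in>Yh. a $ Inl j)"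
  by (simp add: inner_vec_sum switch_shift_def if_distrib sum.If_cases cong: if_cong)

lemma bipartite_edge_endpoints:
  assumes "bipartite_graph X Y E" "{i, j} \<in> E" "j \<in> Y"
  shows "i \<in> X \<and> X \<inter> {i, j} = {i} \<and> Y \<inter> {i, j} = {j}"
proof -
  obtain i' j' where ends: "i' \<in> X" "j' \<in> Y" "{i, j} = {i', j'}"
    using assms unfolding bipartite_graph_def by meson
  moreover have "X \<inter> Y = {}"
    using assms unfolding bipartite_graph_def by simp
  \<comment> \<open>The crosswise match \<open>i = j'\<close>, \<open>j = i'\<close> would put
    \<open>j\<close> into both \<open>X\<close> and \<open>Y\<close>.\<close>
  ultimately have "i \<in> X \<and> i \<notin> Y \<and> j \<notin> X"
    using assms(3) by (auto simp: doubleton_eq_iff)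
  then show ?thesis
    using assms(3) by auto
qed

text \<open>An edge through \<open>i\<close> in \<open>X\<close> that meets \<open>Yh\<close> must
  have its other endpoint in \<open>Yh\<close>, so \<open>j\<close> determines the edge and
  conversely.\<close>

lemma sum_switched_edges:
  assumes "bipartite_graph X Y E" "Yh \<subseteq> Y" "i \<in> X"
  shows "(\<Sum>e\<in>{e \<in> E. (\<exists>j\<in>Yh. j \<in> e) \<and> i \<in> e}. f e) =
    (\<Sum>j\<in>Yh \<inter> neighbours E i. f {i, j})"
proof (rule sum.reindex_bij_betw[symmetric])
  have "e \<in> (\<lambda>j. {i, j}) ` (Yh \<inter> neighbours E i)" if "e \<in> E" "j \<in> Yh" "j \<in> e" "i \<in> e" for e j
  proof -
    have "i \<noteq> j"
      using assms that by (auto simp: bipartite_graph_def)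
    moreover obtain i' j' where "e = {i', j'}"
      using assms(1) \<open>e \<in> E\<close> unfolding bipartite_graph_def by meson
    ultimately have "e = {i, j}"
      using that by auto
    then show ?thesis
      using that by (auto simp: neighbours_def)
  qed
  then show "bij_betw (\<lambda>j. {i, j}) (Yh \<inter> neighbours E i) {e \<in> E. (\<exists>j\<in>Yh. j \<in> e) \<and> i \<in> e}"
    by (auto simp: bij_betw_def inj_on_def doubleton_eq_iff neighbours_def)
qed

text \<open>This is an adjoint computation: the edge term a_ij (x_i - z_ij) adds a_ij to the
  coefficient of x_i and negates that of z_ij.\<close>

lemma inner_switch_linear:
  assumes G: "bipartite_graph X Y E" and a: "a \<in> coord_space X Y E" and Yh: "Yh \<subseteq> Y"
  shows "a \<bullet> switch_linear X E Yh u = switched_coeffs X E Yh a \<bullet> u"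
proof -
  let ?S = "{e \<in> E. \<exists>j\<in>Yh. j \<in> e}"
  let ?D = "\<Sum>i\<in>X. (\<Sum>j\<in>Yh \<inter> neighbours E i. a $ Inr {i, j}) * u $ Inl i"
  have XYh: "X \<inter> Yh = {}"
    using G Yh by (auto simp: bipartite_graph_def)
  \<comment> \<open>\<open>switched_coeffs\<close> negates at every set meeting \<open>Yh\<close>,
    \<open>switch_linear\<close> acts only on edges; the two agree because \<open>a\<close> vanishes
    off \<open>E\<close>.\<close>
  have a0: "a $ Inr e = 0" if "e \<notin> E" for e
    using a that by (auto simp: coord_space_def)
  have "(\<Sum>e\<in>?S. a $ Inr e * (\<Sum>i\<in>X \<inter> e. u $ Inl i)) =
      (\<Sum>e\<in>?S. \<Sum>i | i \<in> X \<and> i \<in> e. a $ Inr e * u $ Inl i)"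
    by (simp add: sum_distrib_left Int_def)
  \<comment> \<open>Double counting of incidences between \<open>X\<close> and the switched edges:
    \<open>?D\<close> is the weight that moves from edges to nodes of \<open>X\<close>.\<close>
  also have "\<dots> = (\<Sum>i\<in>X. \<Sum>e | e \<in> ?S \<and> i \<in> e. a $ Inr e * u $ Inl i)"
    by (rule sum.swap_restrict) auto
  also have "\<dots> = ?D"
    using sum_switched_edges[OF G Yh, of _ "\<lambda>e. a $ Inr e"]
    by (intro sum.cong) (auto simp: sum_distrib_right[symmetric] conj_assoc)
  finally have D: "(\<Sum>e\<in>?S. a $ Inr e * (\<Sum>i\<in>X \<inter> e. u $ Inl i)) = ?D" .
  have "(\<Sum>e\<in>UNIV. a $ Inr e * switch_linear X E Yh u $ Inr e) =
      (\<Sum>e\<in>UNIV. (if e \<in> ?S then a $ Inr e * (\<Sum>i\<in>X \<inter> e. u $ Inl i) else 0) +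
        switched_coeffs X E Yh a $ Inr e * u $ Inr e)"
    by (intro sum.cong refl)
       (auto simp: switch_linear_def switched_coeffs_def a0 algebra_simps)
  also have "\<dots> = ?D + (\<Sum>e\<in>UNIV. switched_coeffs X E Yh a $ Inr e * u $ Inr e)"
    by (simp add: sum.distrib sum.If_cases D[symmetric])
  finally have edges: "(\<Sum>e\<in>UNIV. a $ Inr e * switch_linear X E Yh u $ Inr e) =
      ?D + (\<Sum>e\<in>UNIV. switched_coeffs X E Yh a $ Inr e * u $ Inr e)" .
  \<comment> \<open>The node part is expanded from the switched side, so that the same
    \<open>?D\<close> appears and matches the edge part.\<close>
  have "(\<Sum>v\<in>UNIV. switched_coeffs X E Yh a $ Inl v * u $ Inl v) =
      (\<Sum>v\<in>UNIV. (if v \<in> X then (\<Sum>j\<in>Yh \<inter> neighbours E v. a $ Inr {v, j}) * u $ Inl v else 0) +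
        a $ Inl v * switch_linear X E Yh u $ Inl v)"
    using XYh by (intro sum.cong refl)
       (auto simp: switch_linear_def switched_coeffs_def algebra_simps)
  also have "\<dots> = ?D + (\<Sum>v\<in>UNIV. a $ Inl v * switch_linear X E Yh u $ Inl v)"
    by (simp add: sum.distrib sum.If_cases)
  finally show ?thesis
    using edges by (simp add: inner_vec_sum)
qed

lemma inner_switch:
  assumes "bipartite_graph X Y E" "a \<in> coord_space X Y E" "Yh \<subseteq> Y"
  shows "a \<bullet> switch X E Yh u = switched_coeffs X E Yh a \<bullet> u + (\<Sum>j\<in>Yh. a $ Inl j)"
  by (simp add: switch_def inner_add_right inner_switch_shift inner_switch_linear[OF assms])

text \<open>The generators of the polytope, named so that invariance can be proved for them before
  taking the hull.\<close>

definition bilinear_points ::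
  "'v::finite set \<Rightarrow> 'v set \<Rightarrow> 'v set set \<Rightarrow> 'v set set \<Rightarrow> (real ^ ('v + 'v set)) set" where
  "bilinear_points X Y E \<I> =
     {u \<in> coord_space X Y E.
        (\<forall>k \<in> (X \<union> Y) <+> E. u $ k \<in> {0, 1}) \<and>
        (\<forall>i\<in>X. \<forall>j\<in>Y. {i, j} \<in> E \<longrightarrow> u $ Inl i * u $ Inl j = u $ Inr {i, j}) \<and>
        (\<lambda>i\<in>X. u $ Inl i) \<in> choice_vectors X \<I>}"

text \<open>The product constraint survives because x_i (1 - y_j) = x_i - x_i y_j, and the
  constraints from the partition survive because x is unchanged.\<close>

lemma switch_bilinear_points:
  assumes G: "bipartite_graph X Y E" and Yh: "Yh \<subseteq> Y" and u: "u \<in> bilinear_points X Y E \<I>"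
  shows "switch X E Yh u \<in> bilinear_points X Y E \<I>"
proof -
  let ?w = "switch X E Yh u"
  have XYh: "X \<inter> Yh = {}"
    using G Yh by (auto simp: bipartite_graph_def)
  have u0: "u $ k = 0" if "k \<notin> (X \<union> Y) <+> E" for k
    using u that by (auto simp: bilinear_points_def coord_space_def)
  have u01: "u $ Inl v = 0 \<or> u $ Inl v = 1" if "v \<in> X \<union> Y" for v
    using u that by (auto simp: bilinear_points_def)
  have uprod: "u $ Inr {i, j} = u $ Inl i * u $ Inl j" if "i \<in> X" "j \<in> Y" "{i, j} \<in> E" for i j
    using u that by (auto simp: bilinear_points_def)
  have wX: "?w $ Inl i = u $ Inl i" if "i \<in> X" for i
    using that XYh by auto
  have wprod: "?w $ Inr {i, j} = ?w $ Inl i * ?w $ Inl j"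
    if "i \<in> X" "j \<in> Y" "{i, j} \<in> E" for i j
  proof -
    have ends: "X \<inter> {i, j} = {i}" "Y \<inter> {i, j} = {j}"
      using bipartite_edge_endpoints[OF G] that by auto
    have "(\<exists>l\<in>Yh. l \<in> {i, j}) \<longleftrightarrow> j \<in> Yh"
      using that(1) XYh by auto
    moreover have "i \<notin> Yh"
      using that(1) XYh by auto
    ultimately show ?thesis
      using that by (simp add: ends uprod algebra_simps)
  qed
  have w0: "?w $ k = 0" if "k \<notin> (X \<union> Y) <+> E" for k
    using that u0[OF that] Yh by (cases k) auto
  have wnode: "?w $ Inl v \<in> {0, 1}" if "v \<in> X \<union> Y" for v
    using u01[OF that] by auto
  \<comment> \<open>An edge value is a product of two node values, each 0 or 1.\<close>
  have wedge: "?w $ Inr e \<in> {0, 1}" if e: "e \<in> E" for e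
  proof -
    obtain i j where ij: "i \<in> X" "j \<in> Y" "e = {i, j}"
      using G e by (auto simp: bipartite_graph_def)
    then show ?thesis
      using wprod[of i j] e wnode[of i] wnode[of j] by (auto simp del: switch_nth_Inl switch_nth_Inr)
  qed
  have "(\<lambda>i\<in>X. ?w $ Inl i) = (\<lambda>i\<in>X. u $ Inl i)"
    using wX by (auto simp: restrict_def)
  then show ?thesis
    using u w0 wnode wedge wprod
    by (auto simp: bilinear_points_def coord_space_def simp del: switch_nth_Inl switch_nth_Inr)
qed

lemma switch_image: "switch X E Yh ` S = (+) (switch_shift Yh) ` switch_linear X E Yh ` S"
  by (simp add: image_image switch_def)

lemma switch_bilinear_polytope:
  assumes G: "bipartite_graph X Y E" and Yh: "Yh \<subseteq> Y"
  shows "switch X E Yh ` bilinear_polytope X Y E \<I> = bilinear_polytope X Y E \<I>"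
proof -
  have XYh: "X \<inter> Yh = {}"
    using G Yh by (auto simp: bipartite_graph_def)
  \<comment> \<open>An involution that maps a set into itself maps it onto itself.\<close>
  have "switch X E Yh ` bilinear_points X Y E \<I> = bilinear_points X Y E \<I>"
    using switch_bilinear_points[OF G Yh] switch_involution[OF XYh]
    by (metis equalityI image_eqI image_subsetI subsetI)
  then show ?thesis
    unfolding bilinear_polytope_def bilinear_points_def[symmetric] switch_image
    by (metis convex_hull_linear_image convex_hull_translation linear_switch_linear)
qed

text \<open>Linear maps never raise the affine dimension; applying this to a linear left inverse as
  well gives equality.\<close>

lemma aff_dim_inj_linear_image:
  fixes f :: "'a::euclidean_space \<Rightarrow> 'b::euclidean_space"
  assumes "linear f" "inj f"
  shows "aff_dim (f ` S) = aff_dim S"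
proof (rule antisym)
  obtain g where g: "linear g" "g \<circ> f = id"
    using linear_injective_left_inverse[OF assms] by blast
  then have "g ` f ` S = S"
    by (metis image_comp image_id id_apply)
  then show "aff_dim S \<le> aff_dim (f ` S)"
    using aff_dim_linear_image_le[OF g(1), of "f ` S"] by simp
qed (rule aff_dim_linear_image_le[OF assms(1)])

lemma facet_of_switch_image:
  assumes "X \<inter> Yh = {}" "F facet_of P"
  shows "switch X E Yh ` F facet_of switch X E Yh ` P"
  using assms unfolding switch_image facet_of_def
  by (simp add: face_of_linear_image linear_switch_linear inj_switch_linear aff_dim_translation_eq
      aff_dim_inj_linear_image)

theorem proposition2p6:
  fixes X Y Yh :: "'v::finite set" and E \<I> :: "'v set set"
    and a :: "real ^ ('v + 'v set)" and b :: real
  assumes "bipartite_graph X Y E"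
    and "partition_on X \<I>"
    and "a \<in> coord_space X Y E"
    and "Yh \<subseteq> Y"
  shows "(valid_inequality (bilinear_polytope X Y E \<I>) a b \<longrightarrow>
      valid_inequality (bilinear_polytope X Y E \<I>) (switched_coeffs X E Yh a) (switched_rhs Yh a b)) \<and>
    (facet_inducing (bilinear_polytope X Y E \<I>) a b \<longrightarrow>
      facet_inducing (bilinear_polytope X Y E \<I>) (switched_coeffs X E Yh a) (switched_rhs Yh a b))"
proof -
  let ?P = "bilinear_polytope X Y E \<I>"
  let ?T = "switch X E Yh"
  let ?a = "switched_coeffs X E Yh a" and ?b = "switched_rhs Yh a b"
  have XYh: "X \<inter> Yh = {}"
    using assms by (auto simp: bipartite_graph_def)
  note inner = inner_switch[OF assms(1,3,4)]
  note T_P = switch_bilinear_polytope[OF assms(1,4), of \<I>]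
  note T_T = switch_involution[OF XYh, of E]
  have valid: "valid_inequality ?P ?a ?b" if "valid_inequality ?P a b"
    unfolding valid_inequality_def
  proof
    fix u assume "u \<in> ?P"
    then have "a \<bullet> ?T u \<le> b"
      using that T_P unfolding valid_inequality_def by blast
    then show "?a \<bullet> u \<le> ?b"
      by (simp add: inner switched_rhs_def)
  qed
  \<comment> \<open>The constant from the shift is exactly what \<open>switched_rhs\<close>
    subtracts, so tightness at \<open>u\<close> and at \<open>?T u\<close> correspond.\<close>
  have tight: "a \<bullet> ?T u = b \<longleftrightarrow> ?a \<bullet> u = ?b" for u
    by (auto simp: inner switched_rhs_def)
  have "?T ` (?P \<inter> {u. a \<bullet> u = b}) = ?P \<inter> {u. ?a \<bullet> u = ?b}"
  proof (intro equalityI subsetI)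
    fix w assume "w \<in> ?T ` (?P \<inter> {u. a \<bullet> u = b})"
    then obtain u where u: "u \<in> ?P" "a \<bullet> u = b" "w = ?T u"
      by blast
    then have "?T w = u"
      by (simp only: T_T)
    then have "?a \<bullet> w = ?b"
      using tight[of w] u(2) by simp
    moreover have "w \<in> ?P"
      using T_P u by blast
    ultimately show "w \<in> ?P \<inter> {u. ?a \<bullet> u = ?b}"
      by blast
  next
    fix w assume "w \<in> ?P \<inter> {u. ?a \<bullet> u = ?b}"
    \<comment> \<open>By the involution, \<open>?T w\<close> itself serves as the preimage of
      \<open>w\<close>.\<close>
    then have "?T w \<in> ?P \<inter> {u. a \<bullet> u = b}"
      using T_P tight by blast
    then show "w \<in> ?T ` (?P \<inter> {u. a \<bullet> u = b})"
      by (rule rev_image_eqI) (simp only: T_T)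
  qed
  then have "(?P \<inter> {u. ?a \<bullet> u = ?b}) facet_of ?P" if "(?P \<inter> {u. a \<bullet> u = b}) facet_of ?P"
    using facet_of_switch_image[OF XYh that, of E] T_P by simp
  then show ?thesis
    using valid by (auto simp: facet_inducing_def)
qed

end
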